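(* Let $R$ be a principal ideal semidomain and $S\subsetneq R$ a multiplicative subset. Let $A=(vp^k)$ be an $S$-primary ideal of $R$, where $k\in\mathbb N$ ($k\ge1$), $p\in\mathbf P\setminus\mathbf P_S$, and $v\in R$ with $(v)\cap S\neq\varnothing$. Then its radical $P=\sqrt A$ is an $S$-maximal ideal of $R$.
   Context: Semirings are commutative with unity $1$ and zero $0$. A semidomain is a semiring (with $1\ne 0$) in which $ab=ac$ with $a\neq 0$ implies $b=c$. A principal ideal semidomain is a semidomain in which every ideal is of the form $(a)=\{ra: r\in R\}$ for some $a\in R$. A multiplicative subset of $R$ is a nonempty subset $S\subsetneq R$ with $1\in S$ and $s_1s_2\in S$ for all $s_1,s_2\in S$. $\mathbf P$ denotes the set of all irreducible (equivalently, in a principal ideal semidomain, prime) elements of $R$, and $\mathbf P_S=\{p\in\mathbf P: (p)\cap S\neq\varnothing\}$. The radical of an ideal $I$ is $\sqrt I=\{x\in R: x^n\in I \text{ for some } n\in\mathbb N\}$, $n\geq 1$. An ideal $A$ with $A\cap S=\varnothing$ is $S$-primary if there exists $s\in S$ such that for all $a,b\in R$, $ab\in A$ implies $sa\in A$ or $sb\in\sqrt A$. An ideal $M$ with $M\cap S=\varnothing$ is $S$-maximal if there exists $s\in S$ such that whenever $M\subseteq I$ for some ideal $I$ of $R$, then $sI\subseteq M$ or $I\cap S\neq\varnothing$. *)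

theory Defs
  imports "HOL-Computational_Algebra.Factorial_Ring"
begin

text \<open>
  A semiring is a type of class \<^class>\<open>comm_semiring_1\<close>; the semiring \<open>R\<close> is the
  whole type. Ideals need not be proper.
\<close>

context comm_semiring_1
begin

definition semiring_ideal :: "'a set \<Rightarrow> bool" where
  "semiring_ideal I \<longleftrightarrow>
     I \<noteq> {} \<and> (\<forall>x\<in>I. \<forall>y\<in>I. x + y \<in> I) \<and> (\<forall>r. \<forall>x\<in>I. r * x \<in> I)"

definition principal_ideal :: "'a \<Rightarrow> 'a set" where
  "principal_ideal a = {r * a | r. True}"

definition multiplicative_subset :: "'a set \<Rightarrow> bool" where
  "multiplicative_subset S \<longleftrightarrow>
     S \<subset> UNIV \<and> 1 \<in> S \<and> (\<forall>s\<^sub>1\<in>S. \<forall>s\<^sub>2\<in>S. s\<^sub>1 * s\<^sub>2 \<in> S)"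

definition irreducibles :: "'a set" where
  "irreducibles = {p. irreducible p}"

definition irreducibles_meeting :: "'a set \<Rightarrow> 'a set" where
  "irreducibles_meeting S = {p \<in> irreducibles. principal_ideal p \<inter> S \<noteq> {}}"

definition radical :: "'a set \<Rightarrow> 'a set" where
  "radical I = {x. \<exists>n\<ge>1. x ^ n \<in> I}"

definition S_primary :: "'a set \<Rightarrow> 'a set \<Rightarrow> bool" where
  "S_primary S A \<longleftrightarrow>
     semiring_ideal A \<and> A \<inter> S = {} \<and>
     (\<exists>s\<in>S. \<forall>a b. a * b \<in> A \<longrightarrow> s * a \<in> A \<or> s * b \<in> radical A)"

definition S_maximal :: "'a set \<Rightarrow> 'a set \<Rightarrow> bool" where
  "S_maximal S M \<longleftrightarrow>
     semiring_ideal M \<and> M \<inter> S = {} \<and>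
     (\<exists>s\<in>S. \<forall>I. semiring_ideal I \<longrightarrow> M \<subseteq> I \<longrightarrow> (\<lambda>x. s * x) ` I \<subseteq> M \<or> I \<inter> S \<noteq> {})"

end

text \<open>
  Unlike \<^class>\<open>semidom\<close>, a semidomain is multiplicatively cancellative, and its addition
  need not be cancellative. The condition \<open>1 \<noteq> 0\<close> is part of \<^class>\<open>comm_semiring_1\<close>.
\<close>

class semidomain = comm_semiring_1 +
  assumes semidomain_cancel: "a * b = a * c \<Longrightarrow> a \<noteq> 0 \<Longrightarrow> b = c"

class principal_ideal_semidomain = semidomain +
  assumes ideal_principal: "semiring_ideal I \<Longrightarrow> \<exists>a. I = principal_ideal a"

end

theory Submission
  imports Defs
begin

text \<open>
  Irreducible elements are prime. Let \<open>t = c v \<in> S\<close>; then \<open>t p \<in> \<surd>A\<close>, because \<open>(t p)\<^sup>k\<close> is a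
  multiple of \<open>v p\<^sup>k\<close>. Let \<open>(d)\<close> be an ideal containing \<open>\<surd>A\<close>. If \<open>p\<close> divides \<open>d\<close>, then
  \<open>t (d) \<subseteq> (t p) \<subseteq> \<surd>A\<close>. Otherwise \<open>d\<close> divides \<open>t p\<close> and is not divisible by the prime \<open>p\<close>, so
  cancelling \<open>p\<close> shows that \<open>d\<close> divides \<open>t\<close>, that is, \<open>t \<in> (d) \<inter> S\<close>. Hence \<open>t\<close> witnesses
  \<open>S\<close>-maximality.
\<close>

lemma principal_ideal_iff_dvd:
  fixes a x :: "'a :: comm_semiring_1"
  shows "x \<in> principal_ideal a \<longleftrightarrow> a dvd x"
  unfolding principal_ideal_def dvd_def by (auto simp: mult.commute)

lemma semiring_ideal_add:
  fixes x y :: "'a :: comm_semiring_1"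
  shows "semiring_ideal I \<Longrightarrow> x \<in> I \<Longrightarrow> y \<in> I \<Longrightarrow> x + y \<in> I"
  by (simp add: semiring_ideal_def)

lemma semiring_ideal_mult:
  fixes x r :: "'a :: comm_semiring_1"
  shows "semiring_ideal I \<Longrightarrow> x \<in> I \<Longrightarrow> r * x \<in> I"
  by (simp add: semiring_ideal_def)

lemma semiring_ideal_dvd:
  fixes x y :: "'a :: comm_semiring_1"
  assumes "semiring_ideal I" "x \<in> I" "x dvd y"
  shows "y \<in> I"
  using assms semiring_ideal_mult[of I x] by (auto simp: dvd_def mult.commute)

lemma semiring_ideal_zero:
  fixes I :: "'a :: comm_semiring_1 set"
  assumes "semiring_ideal I"
  shows "0 \<in> I"
proof -
  obtain x where "x \<in> I" using assms by (auto simp: semiring_ideal_def)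
  then show ?thesis using semiring_ideal_dvd[OF assms] by (meson dvd_0_right)
qed

lemma semiring_ideal_sum:
  fixes f :: "'b \<Rightarrow> 'a :: comm_semiring_1"
  assumes "semiring_ideal I" "\<And>i. i \<in> J \<Longrightarrow> f i \<in> I"
  shows "sum f J \<in> I"
  using assms(2)
  by (induction J rule: infinite_finite_induct)
    (auto simp: semiring_ideal_zero[OF assms(1)] intro: semiring_ideal_add[OF assms(1)])

text \<open>Closure under addition rests on the binomial theorem: if \<open>x ^ m\<close> and
  \<open>y ^ n\<close> lie in \<open>I\<close>, every term of the expansion of
  \<open>(x + y) ^ (m + n)\<close> has a factor \<open>x ^ m\<close> or
  \<open>y ^ n\<close>.\<close>

lemma semiring_ideal_radical:
  fixes I :: "'a :: comm_semiring_1 set"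
  assumes I: "semiring_ideal I"
  shows "semiring_ideal (radical I)"
  unfolding semiring_ideal_def
proof (intro conjI ballI allI)
  have "0 ^ 1 \<in> I" using semiring_ideal_zero[OF I] by simp
  then show "radical I \<noteq> {}" unfolding radical_def by blast
next
  fix x y assume "x \<in> radical I" "y \<in> radical I"
  then obtain m n where m: "m \<ge> 1" "x ^ m \<in> I" and n: "n \<ge> 1" "y ^ n \<in> I"
    by (auto simp: radical_def)
  have "of_nat ((m + n) choose i) * x ^ i * y ^ (m + n - i) \<in> I" for i
  proof (cases "m \<le> i")
    case True
    then have "x ^ m dvd of_nat ((m + n) choose i) * x ^ i * y ^ (m + n - i)"
      by (intro dvd_mult2 dvd_mult le_imp_power_dvd)
    then show ?thesis by (rule semiring_ideal_dvd[OF I m(2)])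
  next
    \<comment> \<open>Here i < m, so the exponent \<open>m + n - i\<close> is a genuine difference
      and exceeds \<open>n\<close>.\<close>
    case False
    then have "y ^ n dvd of_nat ((m + n) choose i) * x ^ i * y ^ (m + n - i)"
      by (intro dvd_mult le_imp_power_dvd) simp
    then show ?thesis by (rule semiring_ideal_dvd[OF I n(2)])
  qed
  then have "(x + y) ^ (m + n) \<in> I"
    unfolding binomial_ring by (intro semiring_ideal_sum[OF I])
  moreover have "m + n \<ge> 1" using m by simp
  ultimately show "x + y \<in> radical I" unfolding radical_def by blast
next
  fix r x assume "x \<in> radical I"
  then obtain n where "n \<ge> 1" "x ^ n \<in> I" by (auto simp: radical_def)
  then show "r * x \<in> radical I"
    unfolding radical_def using semiring_ideal_mult[OF I] by (auto simp: power_mult_distrib)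
qed

lemma multiplicative_subset_power:
  fixes s :: "'a :: comm_semiring_1"
  assumes "multiplicative_subset S" "s \<in> S"
  shows "s ^ n \<in> S"
  using assms by (induction n) (auto simp: multiplicative_subset_def)

text \<open>A common element would have all its powers in \<open>S\<close> and one of them in
  \<open>I\<close>.\<close>

lemma radical_Int_multiplicative_subset:
  fixes S I :: "'a :: comm_semiring_1 set"
  assumes "multiplicative_subset S" "I \<inter> S = {}"
  shows "radical I \<inter> S = {}"
  using assms multiplicative_subset_power by (fastforce simp: radical_def)

text \<open>A Bezout argument: the ideal generated by \<open>p\<close> and \<open>a\<close> has a
  single generator \<open>d\<close>, and irreducibility of \<open>p\<close> makes \<open>d\<close> a
  unit unless \<open>p\<close> divides \<open>a\<close>. Then 1 is a combination of \<open>p\<close>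
  and \<open>a\<close> with semiring coefficients.\<close>

lemma irreducible_dvd_mult:
  fixes p a b :: "'a :: principal_ideal_semidomain"
  assumes p: "irreducible p" and dvd: "p dvd a * b"
  shows "p dvd a \<or> p dvd b"
proof (cases "p dvd a")
  case False
  let ?I = "{x * p + y * a | x y. True}"
  have "semiring_ideal ?I"
    unfolding semiring_ideal_def
  proof (intro conjI ballI allI)
    fix u w assume "u \<in> ?I" "w \<in> ?I"
    then obtain x y x' y' where "u = x * p + y * a" "w = x' * p + y' * a" by blast
    then have "u + w = (x + x') * p + (y + y') * a" by (simp add: algebra_simps)
    then show "u + w \<in> ?I" by blast
  next
    fix r u assume "u \<in> ?I"
    then obtain x y where "u = x * p + y * a" by blast
    then have "r * u = (r * x) * p + (r * y) * a" by (simp add: algebra_simps)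
    then show "r * u \<in> ?I" by blast
  qed blast
  then obtain d where d: "?I = principal_ideal d" using ideal_principal by blast
  have "1 * p + 0 * a \<in> ?I" "0 * p + 1 * a \<in> ?I" by blast+
  then have "d dvd p" "d dvd a" unfolding d principal_ideal_iff_dvd by simp_all
  from \<open>d dvd p\<close> obtain e where e: "p = d * e" by (rule dvdE)
  have "\<not> e dvd 1"
  \<comment> \<open>If \<open>e\<close> were a unit, \<open>p\<close> and \<open>d\<close> would be
    associates, and \<open>p\<close> would divide \<open>a\<close> through \<open>d\<close>.\<close>
  proof
    assume "e dvd 1"
    then have "p dvd d" unfolding e using mult_dvd_mono[of d d e 1] by simp
    then show False using \<open>d dvd a\<close> False dvd_trans by blast
  qed
  then have "d dvd 1" using irreducibleD[OF p e] by blast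
  then have "1 \<in> ?I" unfolding d principal_ideal_iff_dvd .
  then obtain x y where xy: "1 = x * p + y * a" by blast
  \<comment> \<open>Multiplying the Bezout identity by \<open>b\<close> writes \<open>b\<close> as a
    sum of two multiples of \<open>p\<close>, the second by the assumption on
    \<open>a * b\<close>.\<close>
  have "p dvd p * (x * b) + y * (a * b)" using dvd by (intro dvd_add) auto
  also have "p * (x * b) + y * (a * b) = (x * p + y * a) * b" by (simp add: algebra_simps)
  also have "\<dots> = b" by (simp flip: xy)
  finally show ?thesis by blast
qed simp

theorem theorem3p5:
  fixes S A P :: "'a :: principal_ideal_semidomain set"
    and v p :: 'a and k :: nat
  assumes "multiplicative_subset S"
    and "S_primary S A"
    and "A = principal_ideal (v * p ^ k)"
    and "k \<ge> 1"
    and "p \<in> irreducibles - irreducibles_meeting S"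
    and "principal_ideal v \<inter> S \<noteq> {}"
    and "P = radical A"
  shows "S_maximal S P"
proof -
  have p: "irreducible p" using assms(5) by (simp add: irreducibles_def)
  have A: "semiring_ideal A" "A \<inter> S = {}" using assms(2) by (auto simp: S_primary_def)
  have P: "semiring_ideal P" unfolding assms(7) by (rule semiring_ideal_radical[OF A(1)])
  obtain t where t: "t \<in> S" "v dvd t"
    using assms(6) unfolding principal_ideal_iff_dvd[symmetric] by blast
  \<comment> \<open>Only one factor \<open>v\<close> has to be found in \<open>(t * p) ^ k\<close>,
    and \<open>t ^ k\<close> supplies it because the exponent is positive.\<close>
  have "t dvd t ^ k" using assms(4) by (intro dvd_power) simp
  then have "v dvd t ^ k" using t(2) dvd_trans by blast
  then have "(t * p) ^ k \<in> A"
    unfolding assms(3) principal_ideal_iff_dvd power_mult_distrib by (intro mult_dvd_mono) auto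
  then have tp: "t * p \<in> P" using assms(4,7) by (auto simp: radical_def)
  have "(\<lambda>x. t * x) ` I \<subseteq> P \<or> I \<inter> S \<noteq> {}" if I: "semiring_ideal I" "P \<subseteq> I" for I
  proof -
    obtain d where d: "I = principal_ideal d" using ideal_principal[OF I(1)] by blast
    show ?thesis
    proof (cases "p dvd d")
      case True
      have "t * x \<in> P" if "x \<in> I" for x
      proof -
        have "p dvd x" using True that dvd_trans unfolding d principal_ideal_iff_dvd by blast
        then show ?thesis using semiring_ideal_dvd[OF P tp] by (simp add: mult_dvd_mono)
      qed
      then show ?thesis by blast
    next
      case False
      have "d dvd t * p" using tp I(2) unfolding d principal_ideal_iff_dvd[symmetric] by blast
      then obtain e where e: "t * p = d * e" by (auto simp: dvd_def)
      then have "p dvd d * e" by (metis dvd_triv_right)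
      then have "p dvd e" using irreducible_dvd_mult[OF p] False by blast
      then obtain f where "e = p * f" by (auto simp: dvd_def)
      \<comment> \<open>The factor \<open>p\<close> is moved to the front to fit
        \<open>semidomain_cancel\<close>; it is nonzero, being irreducible.\<close>
      then have "p * t = p * (d * f)" using e by (simp add: ac_simps)
      moreover have "p \<noteq> 0" using p by (simp add: irreducible_def)
      ultimately have "t = d * f" by (rule semidomain_cancel)
      then have "t \<in> I" by (simp add: d principal_ideal_iff_dvd)
      then show ?thesis using t(1) by blast
    qed
  qed
  moreover have "P \<inter> S = {}"
    unfolding assms(7) by (rule radical_Int_multiplicative_subset[OF assms(1) A(2)])
  ultimately show ?thesis unfolding S_maximal_def using P t(1) by blast
qed

end
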